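(* Let $N$ be a positive integer, $\Omega=\{-1,+1\}^N$, $\hat J\in[0,+\infty)$, let $\mu_N$ be the Gibbs measure of the one-dimensional periodic Ising model with coupling constant $\hat J$, and let $P_{\mathrm W}$ be the transition kernel of the Wolff dynamics with coupling constant $\hat J$. Then for any real-valued function $f$ on $\Omega$, $$E_{\mu_N}[f^2]-(E_{\mu_N}[f])^2\le\frac{e^{2\hat J}(e^{4\hat J}+1)}{2}\Big(\frac12+\hat J e^{\frac{e^{2\hat J}-1}{2}}\Big)N\,\mathcal E^{\mathrm W}_{\mu_N}(f),$$ where $$\mathcal E^{\mathrm W}_{\mu_N}(f)=\frac12\sum_{\sigma,\eta\in\Omega}[f(\sigma)-f(\eta)]^2P_{\mathrm W}(\eta,\sigma)\mu_N(\eta).$$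
   Context: Indices in $[N]=\{1,\dots,N\}$ are cyclic ($N+1\equiv1$). The Gibbs measure is $\mu_N(\sigma)=Z_N^{-1}\exp\big(\hat J\sum_{i=1}^N\sigma_i\sigma_{i+1}\big)$ on $\Omega$, with $Z_N$ the normalizing constant; $E_{\mu_N}$ is expectation with respect to $\mu_N$. $G=([N],\mathcal G)$ is the undirected cycle with the $N$ edges $\{i,i+1\}$, $i=1,\dots,N$ (counted with multiplicity if $N=2$). Wolff dynamics: one step from $\sigma\in\Omega$ is as follows. Choose a site $i_0\in[N]$ uniformly at random and start the cluster with $i_0$. Repeatedly, for each site $i$ in the cluster and each edge joining $i$ to a neighbour $j$ with $\sigma_j=\sigma_i$ such that this edge has not been considered before, add $j$ to the cluster with probability $1-e^{-\hat J(1+\sigma_i\sigma_j)}=1-e^{-2\hat J}$, independently over edges. When no edge remains to be considered, flip all spins of the cluster (with probability 1). Equivalently: declare each edge with aligned endpoint spins open independently with probability $1-e^{-2\hat J}$ (all other edges are closed), and flip the open-connected component of $i_0$. $P_{\mathrm W}(\sigma,\eta)$ is the probability that one step from $\sigma$ produces $\eta$. *)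

theory Defs
  imports "HOL-Probability.Probability"
begin

definition configs :: "nat \<Rightarrow> (nat \<Rightarrow> real) set" where
  "configs N = {1..N} \<rightarrow>\<^sub>E {-1, 1}"

definition csucc :: "nat \<Rightarrow> nat \<Rightarrow> nat" where
  "csucc N i = i mod N + 1"

definition boltzmann :: "nat \<Rightarrow> real \<Rightarrow> (nat \<Rightarrow> real) \<Rightarrow> real" where
  "boltzmann N J \<sigma> = exp (J * (\<Sum>i=1..N. \<sigma> i * \<sigma> (csucc N i)))"

definition gibbs :: "nat \<Rightarrow> real \<Rightarrow> (nat \<Rightarrow> real) \<Rightarrow> real" where
  "gibbs N J \<sigma> = boltzmann N J \<sigma> / (\<Sum>\<tau>\<in>configs N. boltzmann N J \<tau>)"

definition gibbs_expect :: "nat \<Rightarrow> real \<Rightarrow> ((nat \<Rightarrow> real) \<Rightarrow> real) \<Rightarrow> real" where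
  "gibbs_expect N J f = (\<Sum>\<sigma>\<in>configs N. f \<sigma> * gibbs N J \<sigma>)"

text \<open>
  The edges of the cycle are labelled by \<open>k \<in> {1..N}\<close>, edge \<open>k\<close> joining \<open>k\<close> and
  \<open>csucc N k\<close>. The labels keep the two parallel edges for \<open>N = 2\<close> apart; for \<open>N = 1\<close>
  the only edge is a loop. In \<open>cluster N w i\<close>, the function \<open>w\<close> tells which edges are open.
\<close>

definition cluster :: "nat \<Rightarrow> (nat \<Rightarrow> bool) \<Rightarrow> nat \<Rightarrow> nat set" where
  "cluster N w i = {j. (i, j) \<in> {(a, b). \<exists>k\<in>{1..N}. w k \<and> {a, b} = {k, csucc N k}}\<^sup>*}"

definition flip_on :: "nat set \<Rightarrow> (nat \<Rightarrow> real) \<Rightarrow> nat \<Rightarrow> real" where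
  "flip_on C \<sigma> = (\<lambda>i. if i \<in> C then - \<sigma> i else \<sigma> i)"

definition open_edges_pmf :: "nat \<Rightarrow> real \<Rightarrow> (nat \<Rightarrow> real) \<Rightarrow> (nat \<Rightarrow> bool) pmf" where
  "open_edges_pmf N J \<sigma> =
     Pi_pmf {1..N} False
       (\<lambda>k. bernoulli_pmf (if \<sigma> k = \<sigma> (csucc N k) then 1 - exp (- 2 * J) else 0))"

text \<open>
  One Wolff step in its percolation form: revealing the states of the edges one at a time
  while the cluster grows, or all of them beforehand, gives the same law of the cluster.
\<close>

definition wolff_step :: "nat \<Rightarrow> real \<Rightarrow> (nat \<Rightarrow> real) \<Rightarrow> (nat \<Rightarrow> real) pmf" where
  "wolff_step N J \<sigma> = do {
     i \<leftarrow> pmf_of_set {1..N};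
     w \<leftarrow> open_edges_pmf N J \<sigma>;
     return_pmf (flip_on (cluster N w i) \<sigma>)
   }"

definition P_wolff :: "nat \<Rightarrow> real \<Rightarrow> (nat \<Rightarrow> real) \<Rightarrow> (nat \<Rightarrow> real) \<Rightarrow> real" where
  "P_wolff N J \<sigma> \<eta> = pmf (wolff_step N J \<sigma>) \<eta>"

definition dirichlet_wolff :: "nat \<Rightarrow> real \<Rightarrow> ((nat \<Rightarrow> real) \<Rightarrow> real) \<Rightarrow> real" where
  "dirichlet_wolff N J f =
     1 / 2 * (\<Sum>\<sigma>\<in>configs N. \<Sum>\<eta>\<in>configs N.
       (f \<sigma> - f \<eta>)\<^sup>2 * P_wolff N J \<eta> \<sigma> * gibbs N J \<eta>)"

end

theory Submission
  imports Defs
begin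

text \<open>
  The inequality comes from comparing the Wolff dynamics with the single-site heat-bath (Glauber)
  dynamics, in which each site is resampled from its conditional law given the other spins.

  On a cycle with \<open>N \<ge> 2\<close>, the conditional probability that \<open>\<sigma>\<^sub>i = 1\<close> is
  \<open>1/2 + tanh (2 J) (\<sigma>\<^sub>i\<^sub>-\<^sub>1 + \<sigma>\<^sub>i\<^sub>+\<^sub>1) / 4\<close>, so a neighbour influences it by at most
  \<open>tanh (2 J) / 2\<close> and the total influence of a site is at most \<open>\<gamma> = tanh (2 J) < 1\<close>
  (\<open>ising_dobrushin\<close>). Under such a Dobrushin condition, the sum \<open>A\<close> of the heat-bath operators over
  the sites multiplies the Lipschitz seminorm by at most \<open>R = N - 1 + \<gamma>\<close> (\<open>glauber_contracts\<close>).
  As \<open>A\<close> is symmetric in \<open>L\<^sup>2\<close>, the sequence of squared norms of \<open>A\<^sup>n f\<close> is log-convex, and for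
  centred \<open>f\<close> it is \<open>O(R\<^sup>2\<^sup>n)\<close>; hence already its first ratio is at most \<open>R\<^sup>2\<close>
  (\<open>glauber_norm_le\<close>). This turns a contraction in the Lipschitz seminorm into an \<open>L\<^sup>2\<close> bound
  without any spectral theory, and yields the Poincare inequality with constant \<open>1 / (1 - \<gamma>)\<close>, that is
  \<open>(e\<^sup>4\<^sup>J + 1) / 2\<close>, for the heat-bath Dirichlet form (\<open>dobrushin_poincare\<close>).

  The Wolff dynamics flips the single site \<open>i\<close> whenever it starts there and both edges at \<open>i\<close> are
  closed. Keeping only these transitions, its Dirichlet form, multiplied by \<open>N e\<^sup>2\<^sup>J / 2\<close>, dominates the
  heat-bath form: relative to the Gibbs weight, both flows are functions of the ratio of the
  weights before and after the flip, and they compare by the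
  arithmetic-geometric mean inequality (\<open>wolff_dominates_heat_bath\<close>). Together the two steps give the constant
  \<open>e\<^sup>2\<^sup>J (e\<^sup>4\<^sup>J + 1) / 4\<close>, and the claimed constant exceeds it by a multiple of
  \<open>J exp ((e\<^sup>2\<^sup>J - 1) / 2) \<ge> 0\<close>.
\<close>

section \<open>Heat-bath dynamics of a finite spin system\<close>

locale spin_system =
  fixes S :: "'a set" and w :: "('a \<Rightarrow> real) \<Rightarrow> real"
  assumes finite_sites: "finite S"
    and w_pos: "\<sigma> \<in> S \<rightarrow>\<^sub>E {-1, 1} \<Longrightarrow> w \<sigma> > 0"
    and w_total: "(\<Sum>\<sigma>\<in>S \<rightarrow>\<^sub>E {-1, 1}. w \<sigma>) = 1"
begin

abbreviation \<Omega> :: "('a \<Rightarrow> real) set" where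
  "\<Omega> \<equiv> S \<rightarrow>\<^sub>E {-1, 1}"

definition plus_prob :: "'a \<Rightarrow> ('a \<Rightarrow> real) \<Rightarrow> real" where
  "plus_prob i \<sigma> = w (\<sigma>(i := 1)) / (w (\<sigma>(i := 1)) + w (\<sigma>(i := -1)))"

definition heat_bath :: "'a \<Rightarrow> (('a \<Rightarrow> real) \<Rightarrow> real) \<Rightarrow> ('a \<Rightarrow> real) \<Rightarrow> real" where
  "heat_bath i f \<sigma> = plus_prob i \<sigma> * f (\<sigma>(i := 1)) + (1 - plus_prob i \<sigma>) * f (\<sigma>(i := -1))"

text \<open>
  The heat-bath operators are added up rather than averaged, so this is \<open>card S\<close> times the usual
  random-scan transition operator.
\<close>

definition glauber :: "(('a \<Rightarrow> real) \<Rightarrow> real) \<Rightarrow> ('a \<Rightarrow> real) \<Rightarrow> real" where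
  "glauber f \<sigma> = (\<Sum>i\<in>S. heat_bath i f \<sigma>)"

definition inner_w :: "(('a \<Rightarrow> real) \<Rightarrow> real) \<Rightarrow> (('a \<Rightarrow> real) \<Rightarrow> real) \<Rightarrow> real" where
  "inner_w f g = (\<Sum>\<sigma>\<in>\<Omega>. w \<sigma> * f \<sigma> * g \<sigma>)"

definition lipschitz_w :: "real \<Rightarrow> (('a \<Rightarrow> real) \<Rightarrow> real) \<Rightarrow> bool" where
  "lipschitz_w L f \<longleftrightarrow> (\<forall>\<sigma>\<in>\<Omega>. \<forall>i\<in>S. \<bar>f (\<sigma>(i := 1)) - f (\<sigma>(i := -1))\<bar> \<le> L)"

lemma finite_\<Omega>: "finite \<Omega>"
  using finite_sites by (intro finite_PiE) auto

lemma upd_in_\<Omega>: "\<sigma> \<in> \<Omega> \<Longrightarrow> i \<in> S \<Longrightarrow> s = 1 \<or> s = -1 \<Longrightarrow> \<sigma>(i := s) \<in> \<Omega>"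
  by (auto simp: PiE_iff extensional_def)

lemma spin_cases:
  assumes "\<sigma> \<in> \<Omega>" "i \<in> S"
  shows "\<sigma> i = 1 \<or> \<sigma> i = -1"
  using assms by (auto simp: PiE_iff)

text \<open>
  Flipping the spin at \<open>i\<close> permutes the configurations. This brings every sum against \<open>w\<close> into a form in
  which conditioning on the spins outside \<open>i\<close> is visible.
\<close>

lemma sum_over_spin_at:
  assumes i: "i \<in> S"
  shows "(\<Sum>\<sigma>\<in>\<Omega>. F \<sigma>) = (\<Sum>\<sigma>\<in>\<Omega>. F (\<sigma>(i := 1)) + F (\<sigma>(i := -1))) / (2::real)"
proof -
  have "(\<Sum>\<sigma>\<in>\<Omega>. F (\<sigma>(i := - \<sigma> i))) = (\<Sum>\<sigma>\<in>\<Omega>. F \<sigma>)"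
  proof (rule sum.reindex_bij_witness[of _ "\<lambda>\<sigma>. \<sigma>(i := - \<sigma> i)" "\<lambda>\<sigma>. \<sigma>(i := - \<sigma> i)"])
    fix \<sigma> assume "\<sigma> \<in> \<Omega>"
    then show "\<sigma>(i := - \<sigma> i) \<in> \<Omega>"
      using spin_cases[OF _ i] by (intro upd_in_\<Omega> i) auto
    then show "\<sigma>(i := - \<sigma> i) \<in> \<Omega>" .
  qed auto
  moreover have "F \<sigma> + F (\<sigma>(i := - \<sigma> i)) = F (\<sigma>(i := 1)) + F (\<sigma>(i := -1))" if "\<sigma> \<in> \<Omega>" for \<sigma>
    using spin_cases[OF that i]
  proof
    assume s: "\<sigma> i = 1"
    then have "\<sigma>(i := 1) = \<sigma>" by auto
    with s show ?thesis by simp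
  next
    assume s: "\<sigma> i = -1"
    then have "\<sigma>(i := -1) = \<sigma>" by auto
    with s show ?thesis by simp
  qed
  then have "(\<Sum>\<sigma>\<in>\<Omega>. F \<sigma>) + (\<Sum>\<sigma>\<in>\<Omega>. F (\<sigma>(i := - \<sigma> i)))
      = (\<Sum>\<sigma>\<in>\<Omega>. F (\<sigma>(i := 1)) + F (\<sigma>(i := -1)))"
    by (simp add: sum.distrib[symmetric])
  ultimately show ?thesis by simp
qed

lemma heat_bath_upd [simp]: "heat_bath i f (\<sigma>(i := s)) = heat_bath i f \<sigma>"
  by (simp add: heat_bath_def plus_prob_def)

lemma
  assumes "\<sigma> \<in> \<Omega>" "i \<in> S"
  shows plus_prob_nonneg: "plus_prob i \<sigma> \<ge> 0" and plus_prob_le_1: "plus_prob i \<sigma> \<le> 1"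
  using w_pos[OF upd_in_\<Omega>[OF assms, of 1]] w_pos[OF upd_in_\<Omega>[OF assms, of "-1"]]
  by (auto simp: plus_prob_def divide_simps)

lemma heat_bath_weighted:
  assumes "\<sigma> \<in> \<Omega>" "i \<in> S"
  shows "(w (\<sigma>(i := 1)) + w (\<sigma>(i := -1))) * heat_bath i f \<sigma>
    = w (\<sigma>(i := 1)) * f (\<sigma>(i := 1)) + w (\<sigma>(i := -1)) * f (\<sigma>(i := -1))"
proof -
  have *: "x + y \<noteq> 0 \<Longrightarrow> (x + y) * (x / (x + y) * a + (1 - x / (x + y)) * b) = x * a + y * b"
    for x y a b :: real
  proof -
    assume nz: "x + y \<noteq> 0"
    then have "(x + y) * (x / (x + y)) = x" by simp
    then have "(x + y) * (1 - x / (x + y)) = y" by (simp add: right_diff_distrib)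
    with \<open>(x + y) * (x / (x + y)) = x\<close> show ?thesis
      by (simp only: distrib_left mult.assoc[symmetric])
  qed
  show ?thesis
    unfolding heat_bath_def plus_prob_def
    using w_pos[OF upd_in_\<Omega>[OF assms, of 1]] w_pos[OF upd_in_\<Omega>[OF assms, of "-1"]]
    by (intro *) auto
qed

text \<open>
  \<open>heat_bath i\<close> is the conditional expectation given the spins outside \<open>i\<close>, hence an orthogonal
  projection. The right-hand side shows the symmetry in \<open>f\<close> and \<open>g\<close>.
\<close>

lemma inner_heat_bath:
  assumes i: "i \<in> S"
  shows "inner_w (heat_bath i f) g
    = (\<Sum>\<sigma>\<in>\<Omega>. (w (\<sigma>(i := 1)) + w (\<sigma>(i := -1))) * heat_bath i f \<sigma> * heat_bath i g \<sigma>) / 2"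
  unfolding inner_w_def sum_over_spin_at[OF i, of "\<lambda>\<sigma>. w \<sigma> * heat_bath i f \<sigma> * g \<sigma>"]
proof (intro arg_cong[where f = "\<lambda>x. x / 2"] sum.cong refl)
  fix \<sigma> assume s: "\<sigma> \<in> \<Omega>"
  have "(w (\<sigma>(i := 1)) + w (\<sigma>(i := -1))) * heat_bath i f \<sigma> * heat_bath i g \<sigma>
    = heat_bath i f \<sigma> * ((w (\<sigma>(i := 1)) + w (\<sigma>(i := -1))) * heat_bath i g \<sigma>)"
    by simp
  then show "w (\<sigma>(i := 1)) * heat_bath i f (\<sigma>(i := 1)) * g (\<sigma>(i := 1))
      + w (\<sigma>(i := -1)) * heat_bath i f (\<sigma>(i := -1)) * g (\<sigma>(i := -1))
    = (w (\<sigma>(i := 1)) + w (\<sigma>(i := -1))) * heat_bath i f \<sigma> * heat_bath i g \<sigma>"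
    unfolding heat_bath_weighted[OF s i] by (simp add: algebra_simps)
qed

lemma inner_commute: "inner_w f g = inner_w g f"
  by (simp add: inner_w_def mult_ac)

lemma glauber_symmetric: "inner_w (glauber f) g = inner_w f (glauber g)"
proof -
  have sum_left: "inner_w (glauber f) g = (\<Sum>i\<in>S. inner_w (heat_bath i f) g)" for f g
    unfolding inner_w_def glauber_def by (subst sum.swap) (simp add: sum_distrib_left sum_distrib_right)
  have "inner_w (heat_bath i f) g = inner_w (heat_bath i g) f" if "i \<in> S" for i
    unfolding inner_heat_bath[OF that] by (simp add: mult_ac)
  then have "inner_w (glauber f) g = inner_w (glauber g) f"
    by (simp add: sum_left)
  then show ?thesis
    by (simp add: inner_commute)
qed

text \<open>
  The left-hand side is the expected conditional variance at \<open>i\<close>; a variable with the two values \<open>a\<close>, \<open>b\<close>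
  and probabilities \<open>p\<close>, \<open>1 - p\<close> has variance \<open>p (1 - p) (a - b)\<^sup>2\<close>.
\<close>

lemma heat_bath_dirichlet:
  assumes i: "i \<in> S"
  shows "inner_w f f - inner_w (heat_bath i f) f
    = (\<Sum>\<sigma>\<in>\<Omega>. w \<sigma> * w (\<sigma>(i := - \<sigma> i)) / (w \<sigma> + w (\<sigma>(i := - \<sigma> i)))
        * (f \<sigma> - f (\<sigma>(i := - \<sigma> i)))\<^sup>2) / 2"
proof -
  have "inner_w f f - inner_w (heat_bath i f) f = (\<Sum>\<sigma>\<in>\<Omega>.
      (w (\<sigma>(i := 1)) * f (\<sigma>(i := 1)) * f (\<sigma>(i := 1)) + w (\<sigma>(i := -1)) * f (\<sigma>(i := -1)) * f (\<sigma>(i := -1)))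
      - (w (\<sigma>(i := 1)) + w (\<sigma>(i := -1))) * heat_bath i f \<sigma> * heat_bath i f \<sigma>) / 2"
    unfolding inner_heat_bath[OF i]
    unfolding inner_w_def sum_over_spin_at[OF i, of "\<lambda>\<sigma>. w \<sigma> * f \<sigma> * f \<sigma>"]
    by (simp add: sum_subtractf diff_divide_distrib)
  also have "\<dots> = (\<Sum>\<sigma>\<in>\<Omega>. w \<sigma> * w (\<sigma>(i := - \<sigma> i)) / (w \<sigma> + w (\<sigma>(i := - \<sigma> i)))
        * (f \<sigma> - f (\<sigma>(i := - \<sigma> i)))\<^sup>2) / 2"
  proof (intro arg_cong[where f = "\<lambda>x. x / 2"] sum.cong refl)
    fix \<sigma> assume s: "\<sigma> \<in> \<Omega>"
    have key: "x * a * a + y * b * b - (x + y) * h * h = x * y / (x + y) * (a - b)\<^sup>2"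
      if "x > 0" "y > 0" "(x + y) * h = x * a + y * b" for x y a b h :: real
    proof -
      have h: "h = (x * a + y * b) / (x + y)" using that by (simp add: field_simps)
      show ?thesis unfolding h using that(1,2)
        by (simp add: divide_simps) (simp add: algebra_simps power2_eq_square)
    qed
    let ?p = "\<sigma>(i := 1)" and ?m = "\<sigma>(i := -1)"
    have "w ?p * f ?p * f ?p + w ?m * f ?m * f ?m
        - (w ?p + w ?m) * heat_bath i f \<sigma> * heat_bath i f \<sigma>
      = w ?p * w ?m / (w ?p + w ?m) * (f ?p - f ?m)\<^sup>2"
      using w_pos[OF upd_in_\<Omega>[OF s i, of 1]] w_pos[OF upd_in_\<Omega>[OF s i, of "-1"]]
      by (intro key heat_bath_weighted[OF s i]) auto
    also have "\<dots> = w \<sigma> * w (\<sigma>(i := - \<sigma> i)) / (w \<sigma> + w (\<sigma>(i := - \<sigma> i)))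
        * (f \<sigma> - f (\<sigma>(i := - \<sigma> i)))\<^sup>2"
      using spin_cases[OF s i]
    proof
      assume t: "\<sigma> i = 1"
      then have "?p = \<sigma>" by auto
      with t show ?thesis by simp
    next
      assume t: "\<sigma> i = -1"
      then have "?m = \<sigma>" by auto
      with t show ?thesis by (simp add: add.commute mult.commute power2_commute)
    qed
    finally show "w ?p * f ?p * f ?p + w ?m * f ?m * f ?m
        - (w ?p + w ?m) * heat_bath i f \<sigma> * heat_bath i f \<sigma>
      = w \<sigma> * w (\<sigma>(i := - \<sigma> i)) / (w \<sigma> + w (\<sigma>(i := - \<sigma> i)))
        * (f \<sigma> - f (\<sigma>(i := - \<sigma> i)))\<^sup>2" .
  qed
  finally show ?thesis .
qed

lemma glauber_dirichlet:
  "real (card S) * inner_w f f - inner_w (glauber f) f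
    = (\<Sum>i\<in>S. \<Sum>\<sigma>\<in>\<Omega>. w \<sigma> * w (\<sigma>(i := - \<sigma> i)) / (w \<sigma> + w (\<sigma>(i := - \<sigma> i)))
        * (f \<sigma> - f (\<sigma>(i := - \<sigma> i)))\<^sup>2) / 2"
proof -
  have "inner_w (glauber f) f = (\<Sum>i\<in>S. inner_w (heat_bath i f) f)"
    unfolding inner_w_def glauber_def
    by (subst sum.swap) (simp add: sum_distrib_left sum_distrib_right)
  then have "real (card S) * inner_w f f - inner_w (glauber f) f
      = (\<Sum>i\<in>S. inner_w f f - inner_w (heat_bath i f) f)"
    by (simp add: sum_subtractf)
  then show ?thesis
    by (simp add: heat_bath_dirichlet sum_divide_distrib)
qed

lemma inner_nonneg: "inner_w f f \<ge> 0"
  unfolding inner_w_def mult.assoc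
  by (intro sum_nonneg mult_nonneg_nonneg[OF less_imp_le[OF w_pos] zero_le_square])

lemma inner_Cauchy_Schwarz: "(inner_w f g)\<^sup>2 \<le> inner_w f f * inner_w g g"
proof -
  have eq: "inner_w f g = (\<Sum>\<sigma>\<in>\<Omega>. (sqrt (w \<sigma>) * f \<sigma>) * (sqrt (w \<sigma>) * g \<sigma>))" for f g
    unfolding inner_w_def
  proof (intro sum.cong refl)
    fix \<sigma> assume "\<sigma> \<in> \<Omega>"
    then have "sqrt (w \<sigma>) * sqrt (w \<sigma>) = w \<sigma>" using w_pos[of \<sigma>] by simp
    then show "w \<sigma> * f \<sigma> * g \<sigma> = sqrt (w \<sigma>) * f \<sigma> * (sqrt (w \<sigma>) * g \<sigma>)"
      by (metis mult.assoc mult.left_commute)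
  qed
  have "(\<Sum>\<sigma>\<in>\<Omega>. (sqrt (w \<sigma>) * f \<sigma>) * (sqrt (w \<sigma>) * g \<sigma>))\<^sup>2
    \<le> (\<Sum>\<sigma>\<in>\<Omega>. (sqrt (w \<sigma>) * f \<sigma>)\<^sup>2) * (\<Sum>\<sigma>\<in>\<Omega>. (sqrt (w \<sigma>) * g \<sigma>)\<^sup>2)"
    by (rule Cauchy_Schwarz_ineq_sum)
  then show ?thesis unfolding eq by (simp add: power2_eq_square)
qed

section \<open>Dobrushin's condition implies a Poincare inequality\<close>

text \<open>
  One passes from \<open>\<sigma>\<close> to \<open>\<tau>\<close> by changing one site at a time.
\<close>

lemma lipschitz_diff_le:
  assumes L: "lipschitz_w L f" "L \<ge> 0" and s: "\<sigma> \<in> \<Omega>" "\<tau> \<in> \<Omega>"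
  shows "\<bar>f \<sigma> - f \<tau>\<bar> \<le> real (card S) * L"
proof -
  have one: "\<bar>f (\<rho>(i := a)) - f (\<rho>(i := b))\<bar> \<le> L"
    if "\<rho> \<in> \<Omega>" "i \<in> S" "a = 1 \<or> a = -1" "b = 1 \<or> b = -1" for \<rho> i a b
  proof -
    have "\<bar>f (\<rho>(i := 1)) - f (\<rho>(i := -1))\<bar> \<le> L"
      using L that by (auto simp: lipschitz_w_def)
    then show ?thesis using that(3,4) L(2) by (auto simp: abs_minus_commute)
  qed
  have "override_on \<sigma> \<tau> T \<in> \<Omega> \<and> \<bar>f \<sigma> - f (override_on \<sigma> \<tau> T)\<bar> \<le> real (card T) * L"
    if "T \<subseteq> S" for T
    using finite_subset[OF that finite_sites] that
  proof (induction T rule: finite_induct)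
    case empty
    then show ?case using s by simp
  next
    case (insert i T)
    let ?o = "override_on \<sigma> \<tau> T"
    have o: "?o \<in> \<Omega>" and IH: "\<bar>f \<sigma> - f ?o\<bar> \<le> real (card T) * L" and i: "i \<in> S"
      using insert by auto
    have upd: "override_on \<sigma> \<tau> (insert i T) = ?o(i := \<tau> i)"
      by (auto simp: override_on_def)
    have "\<bar>f (?o(i := ?o i)) - f (?o(i := \<tau> i))\<bar> \<le> L"
      using spin_cases[OF o i] spin_cases[OF s(2) i] by (intro one o i) auto
    then have "\<bar>f ?o - f (?o(i := \<tau> i))\<bar> \<le> L" by simp
    with IH have "\<bar>f \<sigma> - f (?o(i := \<tau> i))\<bar> \<le> real (card T) * L + L" by linarith
    moreover have "?o(i := \<tau> i) \<in> \<Omega>"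
      using spin_cases[OF s(2) i] by (intro upd_in_\<Omega> o i) auto
    ultimately show ?case
      unfolding upd using insert.hyps by (simp add: distrib_right add.commute del: fun_upd_apply)
  qed
  from this[of S] have "\<bar>f \<sigma> - f (override_on \<sigma> \<tau> S)\<bar> \<le> real (card S) * L" by simp
  moreover have "override_on \<sigma> \<tau> S = \<tau>"
    using s by (auto simp: override_on_def PiE_iff extensional_def fun_eq_iff)
  ultimately show ?thesis by simp
qed

lemma inner_const_glauber: "inner_w (\<lambda>_. 1) (glauber f) = real (card S) * inner_w (\<lambda>_. 1) f"
proof -
  have "inner_w (\<lambda>_. 1) (glauber f) = inner_w (glauber (\<lambda>_. 1)) f"
    by (simp add: glauber_symmetric)
  also have "glauber (\<lambda>_. 1) = (\<lambda>_. real (card S))"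
    by (simp add: glauber_def heat_bath_def fun_eq_iff)
  finally show ?thesis by (simp add: inner_w_def sum_distrib_left mult_ac)
qed

text \<open>
  A centred function is an average of its own differences, so its Lipschitz seminorm controls its
  supremum and with it the \<open>L\<^sup>2\<close> norm.
\<close>

lemma inner_le_of_lipschitz:
  assumes "lipschitz_w L f" "L \<ge> 0" and mean: "inner_w (\<lambda>_. 1) f = 0"
  shows "inner_w f f \<le> (real (card S) * L)\<^sup>2"
proof -
  have bound: "\<bar>f \<sigma>\<bar> \<le> real (card S) * L" if s: "\<sigma> \<in> \<Omega>" for \<sigma>
  proof -
    have "f \<sigma> = (\<Sum>\<tau>\<in>\<Omega>. w \<tau> * (f \<sigma> - f \<tau>))"
      using mean w_total
      by (simp add: right_diff_distrib sum_subtractf inner_w_def flip: sum_distrib_right)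
    also have "\<bar>\<dots>\<bar> \<le> (\<Sum>\<tau>\<in>\<Omega>. w \<tau> * (real (card S) * L))"
    proof (intro order.trans[OF sum_abs] sum_mono)
      fix \<tau> assume t: "\<tau> \<in> \<Omega>"
      show "\<bar>w \<tau> * (f \<sigma> - f \<tau>)\<bar> \<le> w \<tau> * (real (card S) * L)"
        using w_pos[OF t] lipschitz_diff_le[OF assms(1,2) s t]
        by (simp add: abs_mult)
    qed
    also have "\<dots> = real (card S) * L"
      using w_total by (simp flip: sum_distrib_right)
    finally show ?thesis .
  qed
  have "inner_w f f \<le> (\<Sum>\<sigma>\<in>\<Omega>. w \<sigma> * (real (card S) * L)\<^sup>2)"
    unfolding inner_w_def
  proof (intro sum_mono)
    fix \<sigma> assume s: "\<sigma> \<in> \<Omega>"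
    have "(f \<sigma>)\<^sup>2 \<le> (real (card S) * L)\<^sup>2"
      using bound[OF s] by (rule abs_le_square_iff[THEN iffD1, OF order.trans]) simp
    then show "w \<sigma> * f \<sigma> * f \<sigma> \<le> w \<sigma> * (real (card S) * L)\<^sup>2"
      using w_pos[OF s] by (simp add: power2_eq_square mult.assoc)
  qed
  also have "\<dots> = (real (card S) * L)\<^sup>2"
    using w_total by (simp flip: sum_distrib_right)
  finally show ?thesis .
qed

lemma ex_lipschitz: "\<exists>L\<ge>0. lipschitz_w L f"
proof -
  define L where "L = (\<Sum>\<sigma>\<in>\<Omega>. \<Sum>i\<in>S. \<bar>f (\<sigma>(i := 1)) - f (\<sigma>(i := -1))\<bar>)"
  have "\<bar>f (\<sigma>(i := 1)) - f (\<sigma>(i := -1))\<bar> \<le> L" if "\<sigma> \<in> \<Omega>" "i \<in> S" for \<sigma> i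
  proof -
    have "\<bar>f (\<sigma>(i := 1)) - f (\<sigma>(i := -1))\<bar> \<le> (\<Sum>i\<in>S. \<bar>f (\<sigma>(i := 1)) - f (\<sigma>(i := -1))\<bar>)"
      using that finite_sites by (intro member_le_sum) auto
    also have "\<dots> \<le> L"
      unfolding L_def using that finite_\<Omega>
      by (intro member_le_sum[of \<sigma> \<Omega> "\<lambda>\<sigma>. \<Sum>i\<in>S. \<bar>f (\<sigma>(i := 1)) - f (\<sigma>(i := -1))\<bar>"] sum_nonneg) auto
    finally show ?thesis .
  qed
  moreover have "L \<ge> 0" by (auto simp: L_def intro!: sum_nonneg)
  ultimately show ?thesis by (auto simp: lipschitz_w_def)
qed

end

text \<open>
  Here \<open>c i k\<close> bounds the influence of the spin at \<open>k\<close> on the conditional law at \<open>i\<close>. The sum runs over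
  the influenced sites \<open>i\<close> because the Lipschitz seminorm is a supremum over the site \<open>k\<close> that is changed.
\<close>

locale dobrushin_spin_system = spin_system S w
  for S :: "'a set" and w :: "('a \<Rightarrow> real) \<Rightarrow> real" +
  fixes c :: "'a \<Rightarrow> 'a \<Rightarrow> real" and \<gamma> :: real
  assumes influence: "\<lbrakk>\<sigma> \<in> \<Omega>; i \<in> S; k \<in> S; i \<noteq> k\<rbrakk>
      \<Longrightarrow> \<bar>plus_prob i (\<sigma>(k := 1)) - plus_prob i (\<sigma>(k := -1))\<bar> \<le> c i k"
    and influence_sum: "k \<in> S \<Longrightarrow> (\<Sum>i\<in>S - {k}. c i k) \<le> \<gamma>"
    and \<gamma>_nonneg: "\<gamma> \<ge> 0"
    and nonempty: "S \<noteq> {}"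
begin

definition rate :: real where
  "rate = real (card S) - 1 + \<gamma>"

lemma rate_nonneg: "rate \<ge> 0"
proof -
  have "card S \<ge> 1" using nonempty finite_sites by (simp add: Suc_le_eq card_gt_0_iff)
  then show ?thesis using \<gamma>_nonneg by (simp add: rate_def)
qed

text \<open>
  Two configurations that differ only at \<open>k\<close> are compared site by site. Resampling \<open>k\<close> makes them equal and
  contributes nothing. Resampling \<open>i \<noteq> k\<close> keeps the discrepancy at \<open>k\<close>, which costs \<open>L\<close>, and
  creates one at \<open>i\<close> with probability at most \<open>c i k\<close>.
\<close>

lemma glauber_contracts:
  assumes f: "lipschitz_w L f" "L \<ge> 0"
  shows "lipschitz_w (rate * L) (glauber f)"
  unfolding lipschitz_w_def
proof (intro ballI)
  fix \<sigma> k assume s: "\<sigma> \<in> \<Omega>" and k: "k \<in> S"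
  let ?p = "\<sigma>(k := 1)" and ?m = "\<sigma>(k := -1)"
  have pm: "?p \<in> \<Omega>" "?m \<in> \<Omega>" by (intro upd_in_\<Omega> s k; simp)+
  have site: "\<bar>heat_bath i f ?p - heat_bath i f ?m\<bar> \<le> L + c i k * L" if i: "i \<in> S - {k}" for i
  proof -
    have i': "i \<in> S" "i \<noteq> k" using i by auto
    define q where "q = plus_prob i ?p"
    define r where "r = plus_prob i ?m"
    define fp where "fp s = f (\<sigma>(i := s, k := 1))" for s
    define fm where "fm s = f (\<sigma>(i := s, k := -1))" for s
    have r: "0 \<le> r" "r \<le> 1"
      using plus_prob_nonneg[OF pm(2) i'(1)] plus_prob_le_1[OF pm(2) i'(1)] by (auto simp: r_def)
    have d: "\<bar>fp s - fm s\<bar> \<le> L" if "s = 1 \<or> s = -1" for s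
      using f(1) upd_in_\<Omega>[OF s i'(1) that] k by (auto simp: lipschitz_w_def fp_def fm_def)
    have e: "\<bar>fp 1 - fp (-1)\<bar> \<le> L"
      using f(1) pm i' fun_upd_twist[OF i'(2), of \<sigma>] by (auto simp: lipschitz_w_def fp_def)
    have tw: "\<sigma>(k := a, i := b) = \<sigma>(i := b, k := a)" for a b
      using i'(2) by (simp add: fun_upd_twist)
    \<comment> \<open>The first two terms couple equal new spins at \<open>i\<close>; the last is the failure of the coupling.\<close>
    have "heat_bath i f ?p - heat_bath i f ?m
      = r * (fp 1 - fm 1) + (1 - r) * (fp (-1) - fm (-1)) + (q - r) * (fp 1 - fp (-1))"
      by (simp add: heat_bath_def q_def r_def fp_def fm_def tw algebra_simps)
    also have "\<bar>\<dots>\<bar> \<le> \<bar>r * (fp 1 - fm 1)\<bar> + \<bar>(1 - r) * (fp (-1) - fm (-1))\<bar>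
        + \<bar>(q - r) * (fp 1 - fp (-1))\<bar>" by linarith
    also have "\<dots> \<le> r * L + (1 - r) * L + c i k * L"
    proof -
      have "\<bar>r * (fp 1 - fm 1)\<bar> \<le> r * L"
        using r d[of 1] by (simp add: abs_mult mult_left_mono)
      moreover have "\<bar>(1 - r) * (fp (-1) - fm (-1))\<bar> \<le> (1 - r) * L"
        using r d[of "-1"] by (simp add: abs_mult mult_left_mono)
      moreover have "\<bar>(q - r) * (fp 1 - fp (-1))\<bar> \<le> c i k * L"
        unfolding abs_mult
        using influence[OF s i'(1) k i'(2)] e f(2)
        by (intro mult_mono) (auto simp: q_def r_def)
      ultimately show ?thesis by linarith
    qed
    finally show ?thesis by (simp add: algebra_simps)
  qed
  have "glauber f ?p - glauber f ?m = (\<Sum>i\<in>S. heat_bath i f ?p - heat_bath i f ?m)"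
    by (simp add: glauber_def sum_subtractf)
  also have "\<dots> = (\<Sum>i\<in>S - {k}. heat_bath i f ?p - heat_bath i f ?m)"
    using finite_sites k by (subst sum.remove[of S k]) auto
  also have "\<bar>\<dots>\<bar> \<le> (\<Sum>i\<in>S - {k}. L + c i k * L)"
    by (intro order.trans[OF sum_abs] sum_mono site)
  also have "\<dots> = (real (card S) - 1) * L + (\<Sum>i\<in>S - {k}. c i k) * L"
  proof -
    have "card S \<ge> 1" using k finite_sites by (metis One_nat_def Suc_leI card_gt_0_iff empty_iff)
    then have "real (card (S - {k})) = real (card S) - 1"
      using k by (simp add: card_Diff_singleton of_nat_diff)
    then show ?thesis by (simp add: sum.distrib sum_distrib_right)
  qed
  also have "\<dots> \<le> rate * L"
    using mult_right_mono[OF influence_sum[OF k] f(2)] by (simp add: rate_def algebra_simps)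
  finally show "\<bar>glauber f ?p - glauber f ?m\<bar> \<le> rate * L" .
qed

text \<open>
  With \<open>a n\<close> the squared norm of \<open>A\<^sup>n f\<close>, where \<open>A\<close> is \<open>glauber\<close>, symmetry and Cauchy-Schwarz make the
  ratios \<open>a (n + 1) / a n\<close> nondecreasing. If the first ratio \<open>q\<close> exceeded \<open>rate\<^sup>2\<close>, then \<open>a n\<close> would grow at
  least like \<open>q\<^sup>n\<close>, against the bound of order \<open>rate\<^sup>2\<^sup>n\<close> that the Lipschitz contraction gives.
\<close>

lemma glauber_norm_le:
  assumes mean: "inner_w (\<lambda>_. 1) f = 0"
  shows "inner_w (glauber f) (glauber f) \<le> rate\<^sup>2 * inner_w f f"
proof (rule ccontr)
  assume neg: "\<not> ?thesis"
  define g where "g n = (glauber ^^ n) f" for n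
  define a where "a n = inner_w (g n) (g n)" for n
  obtain L where L: "L \<ge> 0" "lipschitz_w L f" using ex_lipschitz by blast
  have g_mean: "inner_w (\<lambda>_. 1) (g n) = 0" for n
    by (induction n) (auto simp: g_def mean inner_const_glauber)
  have g_lip: "lipschitz_w (rate ^ n * L) (g n)" for n
  proof (induction n)
    case (Suc n)
    then show ?case
      using glauber_contracts[OF Suc] L rate_nonneg by (simp add: g_def mult.assoc)
  qed (simp add: g_def L)
  have upper: "a n \<le> (real (card S) * L)\<^sup>2 * (rate\<^sup>2) ^ n" for n
    using inner_le_of_lipschitz[OF g_lip _ g_mean, of n] L rate_nonneg
    by (simp add: a_def power_mult_distrib mult_ac power2_eq_square)
  have a_nonneg: "a n \<ge> 0" for n by (simp add: a_def inner_nonneg)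
  have convex: "(a (Suc n))\<^sup>2 \<le> a n * a (Suc (Suc n))" for n
  proof -
    have "a (Suc n) = inner_w (g n) (g (Suc (Suc n)))"
      by (simp add: a_def g_def glauber_symmetric)
    then show ?thesis using inner_Cauchy_Schwarz[of "g n" "g (Suc (Suc n))"] by (simp add: a_def)
  qed
  have a01: "a 1 > rate\<^sup>2 * a 0" using neg by (simp add: a_def g_def)
  have a1: "a 1 > 0"
    using a01 a_nonneg[of 0] by (smt (verit) mult_nonneg_nonneg zero_le_power2)
  have a0: "a 0 > 0"
    using convex[of 0] a1 a_nonneg[of 0] by (cases "a 0 = 0") auto
  define q where "q = a 1 / a 0"
  have q: "q > rate\<^sup>2" using a01 a0 by (simp add: q_def field_simps)
  have q0: "q > 0" using a0 a1 by (simp add: q_def)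
  have step: "a n > 0 \<and> q * a n \<le> a (Suc n)" for n
  proof (induction n)
    case 0
    then show ?case using a0 by (simp add: q_def)
  next
    case (Suc n)
    then have pos: "a (Suc n) > 0" using q0 by (smt (verit) mult_pos_pos)
    have "q * a (Suc n) * a n \<le> a (Suc n) * a (Suc n)"
      using mult_right_mono[OF conjunct2[OF Suc], of "a (Suc n)"] pos by (simp add: mult_ac)
    also have "\<dots> \<le> a (Suc (Suc n)) * a n" using convex[of n] by (simp add: power2_eq_square mult_ac)
    finally show ?case using pos Suc by simp
  qed
  have lower: "a 0 * q ^ n \<le> a n" for n
  proof (induction n)
    case (Suc n)
    have "a 0 * q ^ Suc n \<le> q * a n" using Suc q0 by (simp add: mult_ac)
    also have "\<dots> \<le> a (Suc n)" using step by blast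
    finally show ?case .
  qed simp
  have "(\<lambda>n. (real (card S) * L)\<^sup>2 * (rate\<^sup>2 / q) ^ n) \<longlonglongrightarrow> (real (card S) * L)\<^sup>2 * 0"
    using q q0 by (intro tendsto_intros LIMSEQ_realpow_zero) auto
  moreover have "a 0 \<le> (real (card S) * L)\<^sup>2 * (rate\<^sup>2 / q) ^ n" for n
  proof -
    have "a 0 * q ^ n \<le> (real (card S) * L)\<^sup>2 * (rate\<^sup>2) ^ n" using lower upper order.trans by blast
    then show ?thesis using q0 by (simp add: power_divide field_simps)
  qed
  ultimately have "a 0 \<le> (real (card S) * L)\<^sup>2 * 0"
    by (intro LIMSEQ_le_const) auto
  with a0 show False by simp
qed

lemma poincare_centered:
  assumes mean: "inner_w (\<lambda>_. 1) f = 0"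
  shows "(1 - \<gamma>) * inner_w f f
    \<le> (\<Sum>i\<in>S. \<Sum>\<sigma>\<in>\<Omega>. w \<sigma> * w (\<sigma>(i := - \<sigma> i)) / (w \<sigma> + w (\<sigma>(i := - \<sigma> i)))
        * (f \<sigma> - f (\<sigma>(i := - \<sigma> i)))\<^sup>2) / 2"
proof -
  have "(inner_w (glauber f) f)\<^sup>2 \<le> (rate\<^sup>2 * inner_w f f) * inner_w f f"
    by (rule order.trans[OF inner_Cauchy_Schwarz mult_right_mono[OF glauber_norm_le[OF mean] inner_nonneg]])
  also have "\<dots> = (rate * inner_w f f)\<^sup>2" by (simp add: power2_eq_square)
  finally have "inner_w (glauber f) f \<le> rate * inner_w f f"
    by (rule power2_le_imp_le) (intro mult_nonneg_nonneg rate_nonneg inner_nonneg)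
  then have "(1 - \<gamma>) * inner_w f f \<le> real (card S) * inner_w f f - inner_w (glauber f) f"
    by (simp add: rate_def algebra_simps)
  then show ?thesis by (simp only: glauber_dirichlet)
qed

text \<open>
  The right-hand side is the heat-bath Dirichlet form: \<open>w \<sigma> w \<sigma>' / (w \<sigma> + w \<sigma>')\<close> is the
  stationary flow between \<open>\<sigma>\<close> and its flip \<open>\<sigma>'\<close> when site \<open>i\<close> is resampled.
\<close>

theorem dobrushin_poincare:
  "(1 - \<gamma>) * ((\<Sum>\<sigma>\<in>\<Omega>. (f \<sigma>)\<^sup>2 * w \<sigma>) - (\<Sum>\<sigma>\<in>\<Omega>. f \<sigma> * w \<sigma>)\<^sup>2)
    \<le> (\<Sum>i\<in>S. \<Sum>\<sigma>\<in>\<Omega>. w \<sigma> * w (\<sigma>(i := - \<sigma> i)) / (w \<sigma> + w (\<sigma>(i := - \<sigma> i)))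
        * (f \<sigma> - f (\<sigma>(i := - \<sigma> i)))\<^sup>2) / 2"
proof -
  define m where "m = (\<Sum>\<sigma>\<in>\<Omega>. f \<sigma> * w \<sigma>)"
  define g where "g \<sigma> = f \<sigma> - m" for \<sigma>
  have mean: "inner_w (\<lambda>_. 1) g = 0"
    using w_total
    by (simp add: inner_w_def g_def right_diff_distrib sum_subtractf m_def mult.commute
        flip: sum_distrib_right sum_distrib_left)
  have "inner_w g g = (\<Sum>\<sigma>\<in>\<Omega>. (f \<sigma>)\<^sup>2 * w \<sigma> - 2 * m * (f \<sigma> * w \<sigma>) + m\<^sup>2 * w \<sigma>)"
    unfolding inner_w_def g_def by (intro sum.cong) (auto simp: power2_eq_square algebra_simps)
  also have "\<dots> = (\<Sum>\<sigma>\<in>\<Omega>. (f \<sigma>)\<^sup>2 * w \<sigma>) - 2 * m * m + m\<^sup>2"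
    using w_total by (simp add: sum.distrib sum_subtractf m_def flip: sum_distrib_left)
  finally have "inner_w g g = (\<Sum>\<sigma>\<in>\<Omega>. (f \<sigma>)\<^sup>2 * w \<sigma>) - m\<^sup>2" by (simp add: power2_eq_square)
  then show ?thesis using poincare_centered[OF mean] by (simp add: g_def m_def)
qed

end

section \<open>Local structure of the Ising cycle\<close>

definition cpred :: "nat \<Rightarrow> nat \<Rightarrow> nat" where
  "cpred N i = (if i = 1 then N else i - 1)"

lemma csucc_eq: "i \<in> {1..N} \<Longrightarrow> csucc N i = (if i = N then 1 else i + 1)"
  by (auto simp: csucc_def)

lemma csucc_in: "i \<in> {1..N} \<Longrightarrow> csucc N i \<in> {1..N}"
  by (auto simp: csucc_eq)

lemma cpred_in: "i \<in> {1..N} \<Longrightarrow> cpred N i \<in> {1..N}"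
  by (auto simp: cpred_def)

lemma csucc_eq_iff: "k \<in> {1..N} \<Longrightarrow> i \<in> {1..N} \<Longrightarrow> csucc N k = i \<longleftrightarrow> k = cpred N i"
  by (auto simp: csucc_eq cpred_def)

lemma csucc_neq: "N \<ge> 2 \<Longrightarrow> i \<in> {1..N} \<Longrightarrow> csucc N i \<noteq> i"
  by (auto simp: csucc_eq)

lemma cpred_neq: "N \<ge> 2 \<Longrightarrow> i \<in> {1..N} \<Longrightarrow> cpred N i \<noteq> i"
  by (auto simp: cpred_def)

lemma spin_of_config: "\<sigma> \<in> configs N \<Longrightarrow> i \<in> {1..N} \<Longrightarrow> \<sigma> i = 1 \<or> \<sigma> i = -1"
  by (auto simp: configs_def PiE_iff)

lemma flip_in_configs: "\<sigma> \<in> configs N \<Longrightarrow> i \<in> {1..N} \<Longrightarrow> \<sigma>(i := - \<sigma> i) \<in> configs N"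
  using spin_of_config[of \<sigma> N i] by (auto simp: configs_def PiE_iff extensional_def)

lemma finite_configs: "finite (configs N)"
  by (auto simp: configs_def intro!: finite_PiE)

text \<open>
  For a single site the only edge is a loop, whose energy does not depend on the spin; hence the value 0.
\<close>

definition local_field :: "nat \<Rightarrow> nat \<Rightarrow> (nat \<Rightarrow> real) \<Rightarrow> real" where
  "local_field N i \<sigma> = (if N = 1 then 0 else \<sigma> (cpred N i) + \<sigma> (csucc N i))"

lemma boltzmann_upd:
  assumes i: "i \<in> {1..N}"
  obtains B where "B > 0" "\<And>s. s = 1 \<or> s = -1 \<Longrightarrow> boltzmann N J (\<sigma>(i := s)) = B * exp (J * s * local_field N i \<sigma>)"
proof (cases "N = 1")
  case True
  with i have [simp]: "N = 1" "i = 1" by auto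
  have "boltzmann N J (\<sigma>(i := s)) = exp J * exp (J * s * local_field N i \<sigma>)"
    if "s = 1 \<or> s = -1" for s
    using that by (auto simp: boltzmann_def csucc_def local_field_def)
  then show ?thesis using that[of "exp J"] by auto
next
  case False
  with i have N: "N \<ge> 2" by auto
  define R where "R = (\<Sum>k\<in>{1..N} - {i} - {cpred N i}. \<sigma> k * \<sigma> (csucc N k))"
  have "boltzmann N J (\<sigma>(i := s)) = exp (J * R) * exp (J * s * local_field N i \<sigma>)" for s
  proof -
    let ?t = "\<sigma>(i := s)"
    have p: "cpred N i \<in> {1..N} - {i}" using cpred_in[OF i] cpred_neq[OF N i] by simp
    have "(\<Sum>k=1..N. ?t k * ?t (csucc N k))
      = ?t i * ?t (csucc N i) + (?t (cpred N i) * ?t (csucc N (cpred N i))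
        + (\<Sum>k\<in>{1..N} - {i} - {cpred N i}. ?t k * ?t (csucc N k)))"
      using i p by (subst sum.remove[of _ i], simp, simp, subst sum.remove[of _ "cpred N i"]) auto
    also have "(\<Sum>k\<in>{1..N} - {i} - {cpred N i}. ?t k * ?t (csucc N k)) = R"
      unfolding R_def
    proof (intro sum.cong refl)
      fix k assume k: "k \<in> {1..N} - {i} - {cpred N i}"
      then have "csucc N k \<noteq> i" using csucc_eq_iff[of k N i] i by auto
      then show "?t k * ?t (csucc N k) = \<sigma> k * \<sigma> (csucc N k)" using k by auto
    qed
    also have "csucc N (cpred N i) = i" using csucc_eq_iff[OF cpred_in[OF i] i] by simp
    finally have "(\<Sum>k=1..N. ?t k * ?t (csucc N k)) = s * local_field N i \<sigma> + R"
      using csucc_neq[OF N i] cpred_neq[OF N i] False by (simp add: local_field_def algebra_simps)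
    then show ?thesis by (simp add: boltzmann_def exp_add[symmetric] algebra_simps)
  qed
  then show ?thesis using that[of "exp (J * R)"] by auto
qed

lemma partition_pos: "(\<Sum>\<tau>\<in>configs N. boltzmann N J \<tau>) > 0"
proof -
  have "(\<lambda>i\<in>{1..N}. 1) \<in> configs N" by (auto simp: configs_def)
  then show ?thesis
    by (intro sum_pos finite_configs) (auto simp: boltzmann_def)
qed

lemma gibbs_pos: "gibbs N J \<sigma> > 0"
  unfolding gibbs_def by (intro divide_pos_pos partition_pos) (simp add: boltzmann_def)

lemma gibbs_upd:
  assumes i: "i \<in> {1..N}"
  obtains B where "B > 0" "\<And>s. s = 1 \<or> s = -1 \<Longrightarrow> gibbs N J (\<sigma>(i := s)) = B * exp (J * s * local_field N i \<sigma>)"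
proof -
  obtain B where B: "B > 0" "\<And>s. s = 1 \<or> s = -1 \<Longrightarrow> boltzmann N J (\<sigma>(i := s)) = B * exp (J * s * local_field N i \<sigma>)"
    using boltzmann_upd[OF i] by blast
  have "B / (\<Sum>\<tau>\<in>configs N. boltzmann N J \<tau>) > 0"
    using B partition_pos[of N J] by simp
  moreover have "gibbs N J (\<sigma>(i := s)) = B / (\<Sum>\<tau>\<in>configs N. boltzmann N J \<tau>) * exp (J * s * local_field N i \<sigma>)"
    if "s = 1 \<or> s = -1" for s
    unfolding gibbs_def B(2)[OF that] by simp
  ultimately show ?thesis using that by blast
qed

lemma ising_spin_system: "spin_system {1..N} (gibbs N J)"
proof
  show "(\<Sum>\<sigma>\<in>{1..N} \<rightarrow>\<^sub>E {-1, 1}. gibbs N J \<sigma>) = 1"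
    using partition_pos[of N J] unfolding configs_def[symmetric] gibbs_def
    by (simp flip: sum_divide_distrib)
qed (auto simp: gibbs_pos)

text \<open>
  The conditional probability is \<open>(1 + tanh (J h)) / 2\<close> with \<open>h\<close> the local field. It is affine in
  \<open>h\<close> because \<open>h\<close> takes only the values \<open>-2, 0, 2\<close> and \<open>tanh\<close> is odd.
\<close>

lemma ising_plus_prob:
  assumes i: "i \<in> {1..N}" and s: "\<sigma> \<in> configs N"
  shows "spin_system.plus_prob (gibbs N J) i \<sigma> = 1 / 2 + tanh (2 * J) * local_field N i \<sigma> / 4"
proof -
  interpret spin_system "{1..N}" "gibbs N J" by (rule ising_spin_system)
  let ?h = "local_field N i \<sigma>"
  obtain B where B: "B > 0" "\<And>s. s = 1 \<or> s = -1 \<Longrightarrow> gibbs N J (\<sigma>(i := s)) = B * exp (J * s * local_field N i \<sigma>)"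
    using gibbs_upd[OF i] by blast
  have gp: "gibbs N J (\<sigma>(i := 1)) = B * exp (J * ?h)" and gm: "gibbs N J (\<sigma>(i := -1)) = B * exp (- (J * ?h))"
    using B(2)[of 1] B(2)[of "-1"] by auto
  have "plus_prob i \<sigma> = exp (J * ?h) / (exp (J * ?h) + exp (- (J * ?h)))"
    using B(1) unfolding plus_prob_def gp gm by (simp flip: distrib_left)
  also have "\<dots> = 1 / 2 + tanh (J * ?h) / 2"
    unfolding tanh_altdef by (simp add: field_simps add_pos_pos less_imp_neq[THEN not_sym])
  also have "tanh (J * ?h) = tanh (2 * J) * ?h / 2"
  proof -
    have "?h = 0 \<or> ?h = 2 \<or> ?h = -2"
      using spin_of_config[OF s cpred_in[OF i]] spin_of_config[OF s csucc_in[OF i]]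
      by (auto simp: local_field_def)
    moreover have "tanh (J * 2) = tanh (2 * J)" by (simp add: mult.commute)
    ultimately show ?thesis by (auto simp: tanh_minus)
  qed
  finally show ?thesis by simp
qed

text \<open>
  Both indicators are kept separately since for \<open>N = 2\<close> the two neighbours of a site coincide and their
  influences add up.
\<close>

lemma ising_dobrushin:
  assumes N: "N \<ge> 1" and J: "J \<ge> 0"
  shows "dobrushin_spin_system {1..N} (gibbs N J)
    (\<lambda>i k. tanh (2 * J) / 2 * (of_bool (cpred N i = k) + of_bool (csucc N i = k))) (tanh (2 * J))"
proof -
  interpret spin_system "{1..N}" "gibbs N J" by (rule ising_spin_system)
  have t: "tanh (2 * J) \<ge> 0" using J by (simp add: tanh_real_nonneg_iff)
  show ?thesis
  proof
    fix \<sigma> i k assume s: "\<sigma> \<in> \<Omega>" and i: "i \<in> {1..N}" and k: "k \<in> {1..N}" and ik: "i \<noteq> k"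
    have up: "\<sigma>(k := s) \<in> configs N" if "s = 1 \<or> s = -1" for s
      using upd_in_\<Omega>[OF s k that] by (simp add: configs_def)
    have "N \<noteq> 1" using i k ik by auto
    then have "local_field N i (\<sigma>(k := 1)) - local_field N i (\<sigma>(k := -1))
        = 2 * (of_bool (cpred N i = k) + of_bool (csucc N i = k))"
      by (auto simp: local_field_def)
    moreover have "plus_prob i (\<sigma>(k := 1)) - plus_prob i (\<sigma>(k := -1))
      = tanh (2 * J) / 4 * (local_field N i (\<sigma>(k := 1)) - local_field N i (\<sigma>(k := -1)))"
      using ising_plus_prob[OF i up[of 1]] ising_plus_prob[OF i up[of "-1"]] by (simp add: algebra_simps)
    ultimately have "plus_prob i (\<sigma>(k := 1)) - plus_prob i (\<sigma>(k := -1))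
      = tanh (2 * J) / 4 * (2 * (of_bool (cpred N i = k) + of_bool (csucc N i = k)))"
      by (simp only:)
    also have "\<dots> = tanh (2 * J) / 2 * (of_bool (cpred N i = k) + of_bool (csucc N i = k))"
      by simp
    finally have diff: "plus_prob i (\<sigma>(k := 1)) - plus_prob i (\<sigma>(k := -1))
      = tanh (2 * J) / 2 * (of_bool (cpred N i = k) + of_bool (csucc N i = k))" .
    show "\<bar>plus_prob i (\<sigma>(k := 1)) - plus_prob i (\<sigma>(k := -1))\<bar>
        \<le> tanh (2 * J) / 2 * (of_bool (cpred N i = k) + of_bool (csucc N i = k))"
      unfolding diff using t by (subst abs_of_nonneg) auto
  next
    fix k assume k: "k \<in> {1..N}"
    have c1: "cpred N i = k \<longleftrightarrow> i = csucc N k" if "i \<in> {1..N}" for i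
      using csucc_eq_iff[OF k that] by auto
    have c2: "csucc N i = k \<longleftrightarrow> i = cpred N k" if "i \<in> {1..N}" for i
      using csucc_eq_iff[OF that k] by auto
    have "(\<Sum>i\<in>{1..N} - {k}. of_bool (cpred N i = k) + of_bool (csucc N i = k) :: real)
      \<le> (\<Sum>i\<in>{1..N}. of_bool (cpred N i = k) + of_bool (csucc N i = k))"
      by (intro sum_mono2) auto
    also have "\<dots> = (\<Sum>i\<in>{1..N}. (if i = csucc N k then 1 else 0) + (if i = cpred N k then 1 else 0))"
      by (intro sum.cong) (auto simp: c1 c2)
    also have "\<dots> = 2"
      unfolding sum.distrib using csucc_in[OF k] cpred_in[OF k] by (simp add: sum.delta')
    finally have count: "(\<Sum>i\<in>{1..N} - {k}. of_bool (cpred N i = k) + of_bool (csucc N i = k) :: real) \<le> 2" .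
    show "(\<Sum>i\<in>{1..N} - {k}. tanh (2 * J) / 2 * (of_bool (cpred N i = k) + of_bool (csucc N i = k)))
        \<le> tanh (2 * J)"
      unfolding sum_distrib_left[symmetric] using mult_left_mono[OF count, of "tanh (2 * J) / 2"] t by simp
  qed (use t N in auto)
qed

section \<open>Single-site clusters of the Wolff dynamics\<close>

lemma cluster_singleton:
  assumes i: "i \<in> {1..N}" and closed: "\<not> v i" "\<not> v (cpred N i)"
  shows "cluster N v i = {i}"
proof -
  let ?R = "{(a, b). \<exists>k\<in>{1..N}. v k \<and> {a, b} = {k, csucc N k}}"
  have no: "(i, b) \<notin> ?R" for b
  proof
    assume "(i, b) \<in> ?R"
    then obtain k where k: "k \<in> {1..N}" "v k" "{i, b} = {k, csucc N k}" by auto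
    then have "i = k \<or> csucc N k = i" by (auto simp: doubleton_eq_iff)
    then show False using csucc_eq_iff[OF k(1) i] k(2) closed by auto
  qed
  have "j = i" if "(i, j) \<in> ?R\<^sup>*" for j
    using that no by (auto elim: converse_rtranclE)
  then show ?thesis by (auto simp: cluster_def)
qed

lemma P_wolff_flip_ge:
  assumes i: "i \<in> {1..N}"
    and E: "E = {v. flip_on (cluster N v i) \<sigma> = \<sigma>(i := - \<sigma> i)}"
  shows "real N * P_wolff N J \<sigma> (\<sigma>(i := - \<sigma> i)) \<ge> measure_pmf.prob (open_edges_pmf N J \<sigma>) E"
proof -
  let ?x = "\<sigma>(i := - \<sigma> i)"
  let ?g = "\<lambda>j. open_edges_pmf N J \<sigma> \<bind> (\<lambda>v. return_pmf (flip_on (cluster N v j) \<sigma>))"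
  have ne: "{1..N} \<noteq> {}" using i by auto
  have "P_wolff N J \<sigma> ?x = (\<Sum>j\<in>{1..N}. pmf (?g j) ?x) / real N"
    unfolding P_wolff_def wolff_step_def by (subst pmf_bind_pmf_of_set[OF ne]) auto
  then have "real N * P_wolff N J \<sigma> ?x = (\<Sum>j\<in>{1..N}. pmf (?g j) ?x)"
    using i by simp
  also have "\<dots> \<ge> pmf (?g i) ?x"
    using i by (intro member_le_sum) auto
  also have "pmf (?g i) ?x = measure_pmf.prob (open_edges_pmf N J \<sigma>) E"
    unfolding map_pmf_def[symmetric] pmf_map by (simp add: E vimage_def)
  finally show ?thesis .
qed

lemma prob_two_edges_closed:
  assumes ab: "a \<in> {1..N}" "b \<in> {1..N}" "a \<noteq> b" and J: "J \<ge> 0"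
  shows "measure_pmf.prob (open_edges_pmf N J \<sigma>) {v. \<not> v a \<and> \<not> v b}
    = (if \<sigma> a = \<sigma> (csucc N a) then exp (- 2 * J) else 1) * (if \<sigma> b = \<sigma> (csucc N b) then exp (- 2 * J) else 1)"
proof -
  let ?p = "\<lambda>k. bernoulli_pmf (if \<sigma> k = \<sigma> (csucc N k) then 1 - exp (- 2 * J) else 0)"
  let ?B = "\<lambda>k. if k = a \<or> k = b then {False} else UNIV"
  have "{v. \<not> v a \<and> \<not> v b} = Pi {1..N} ?B"
    using ab by (auto simp: Pi_def)
  then have "measure_pmf.prob (open_edges_pmf N J \<sigma>) {v. \<not> v a \<and> \<not> v b}
      = (\<Prod>k\<in>{1..N}. measure_pmf.prob (?p k) (?B k))"
    unfolding open_edges_pmf_def by (simp only: measure_Pi_pmf_Pi[OF finite_atLeastAtMost])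
  also have "\<dots> = (\<Prod>k\<in>{a, b}. measure_pmf.prob (?p k) (?B k))"
    using ab by (intro prod.mono_neutral_right) auto
  also have "\<dots> = measure_pmf.prob (?p a) {False} * measure_pmf.prob (?p b) {False}"
    using ab by simp
  finally have "measure_pmf.prob (open_edges_pmf N J \<sigma>) {v. \<not> v a \<and> \<not> v b}
      = measure_pmf.prob (?p a) {False} * measure_pmf.prob (?p b) {False}" .
  moreover have "measure_pmf.prob (?p k) {False} = (if \<sigma> k = \<sigma> (csucc N k) then exp (- 2 * J) else 1)" for k
    using J by (simp add: measure_pmf_single)
  ultimately show ?thesis by (simp only:)
qed

text \<open>
  Let \<open>x\<^sup>2\<close> be the ratio of the Gibbs weights after and before the flip. For \<open>N \<ge> 2\<close>, if \<open>n\<close> of the two edges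
  at \<open>i\<close> are aligned, then \<open>x = e\<^sup>2\<^sup>J\<^sup>(\<^sup>1\<^sup>-\<^sup>n\<^sup>)\<close>, while both edges are closed with probability
  \<open>e\<^sup>-\<^sup>2\<^sup>J\<^sup>n = e\<^sup>-\<^sup>2\<^sup>J x\<close>. The claim is then \<open>x\<^sup>2 / (1 + x\<^sup>2) \<le> x / 2\<close>.
\<close>

lemma wolff_dominates_heat_bath:
  assumes i: "i \<in> {1..N}" and s: "\<sigma> \<in> configs N" and J: "J \<ge> 0"
  shows "gibbs N J \<sigma> * gibbs N J (\<sigma>(i := - \<sigma> i)) / (gibbs N J \<sigma> + gibbs N J (\<sigma>(i := - \<sigma> i)))
    \<le> exp (2 * J) / 2 * (real N * P_wolff N J \<sigma> (\<sigma>(i := - \<sigma> i)) * gibbs N J \<sigma>)"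
proof -
  let ?h = "local_field N i \<sigma>" and ?t = "\<sigma>(i := - \<sigma> i)"
  define E where "E = {v. flip_on (cluster N v i) \<sigma> = ?t}"
  define x where "x = exp (- (J * \<sigma> i * ?h))"
  have x: "x > 0" by (simp add: x_def)
  have closed: "v \<in> E" if "\<not> v i" "\<not> v (cpred N i)" for v
    using cluster_singleton[of i N v, OF i that] by (auto simp: E_def flip_on_def fun_eq_iff)
  have "exp (- 2 * J) * x \<le> measure_pmf.prob (open_edges_pmf N J \<sigma>) E"
  proof (cases "N = 1")
    case True
    then have [simp]: "i = 1" "N = 1" using i by auto
    \<comment> \<open>The only edge is a loop, so the cluster is a single site whether or not the loop is open.\<close>
    have "cluster N v i = {i}" for v
    proof -
      have "{(a, b). \<exists>k\<in>{1..N}. v k \<and> {a, b} = {k, csucc N k}} \<subseteq> Id"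
        by (auto simp: csucc_def)
      from rtrancl_mono[OF this] show ?thesis
        by (auto simp: cluster_def)
    qed
    then have "E = UNIV" by (auto simp: E_def flip_on_def fun_eq_iff)
    then show ?thesis using J by (simp add: x_def local_field_def)
  next
    case False
    with i have N: "N \<ge> 2" by auto
    let ?p = "cpred N i"
    have sp: "csucc N ?p = i" using csucc_eq_iff[OF cpred_in[OF i] i] by simp
    have "exp (- 2 * J) * x = (if \<sigma> i = \<sigma> (csucc N i) then exp (- 2 * J) else 1)
        * (if \<sigma> ?p = \<sigma> (csucc N ?p) then exp (- 2 * J) else 1)"
      using spin_of_config[OF s i] spin_of_config[OF s cpred_in[OF i]] spin_of_config[OF s csucc_in[OF i]] False
      by (auto simp: x_def local_field_def sp simp flip: exp_add)
    also have "\<dots> = measure_pmf.prob (open_edges_pmf N J \<sigma>) {v. \<not> v i \<and> \<not> v ?p}"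
      using prob_two_edges_closed[OF i cpred_in[OF i] cpred_neq[OF N i, symmetric] J] by simp
    also have "\<dots> \<le> measure_pmf.prob (open_edges_pmf N J \<sigma>) E"
      by (intro measure_pmf.finite_measure_mono) (auto intro: closed)
    finally show ?thesis .
  qed
  also have "\<dots> \<le> real N * P_wolff N J \<sigma> ?t"
    by (rule P_wolff_flip_ge[OF i E_def])
  finally have P: "exp (- 2 * J) * x \<le> real N * P_wolff N J \<sigma> ?t" .
  have ratio: "gibbs N J ?t = x\<^sup>2 * gibbs N J \<sigma>"
  proof -
    obtain B where B: "B > 0" "\<And>s. s = 1 \<or> s = -1 \<Longrightarrow> gibbs N J (\<sigma>(i := s)) = B * exp (J * s * ?h)"
      using gibbs_upd[OF i] by blast
    have "gibbs N J \<sigma> = B * exp (J * \<sigma> i * ?h)" "gibbs N J ?t = B * exp (J * (- \<sigma> i) * ?h)"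
      using B(2)[of "\<sigma> i"] B(2)[of "- \<sigma> i"] spin_of_config[OF s i] by auto
    then show ?thesis
      by (simp add: x_def flip: exp_double exp_add)
  qed
  have g: "gibbs N J \<sigma> > 0" by (rule gibbs_pos)
  have "gibbs N J \<sigma> * gibbs N J ?t / (gibbs N J \<sigma> + gibbs N J ?t) = gibbs N J \<sigma> * (x\<^sup>2 / (1 + x\<^sup>2))"
  proof -
    have "gibbs N J \<sigma> + gibbs N J ?t = gibbs N J \<sigma> * (1 + x\<^sup>2)" by (simp add: ratio algebra_simps)
    then show ?thesis using g by (simp add: ratio)
  qed
  also have "\<dots> \<le> gibbs N J \<sigma> * (x / 2)"
  proof -
    have "x * (2 * x) \<le> x * (1 + x\<^sup>2)"
      using x sum_squares_bound[of 1 x] by (intro mult_left_mono) auto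
    then have "x\<^sup>2 / (1 + x\<^sup>2) \<le> x / 2"
      by (simp add: divide_simps add_pos_nonneg power2_eq_square mult_ac)
    then show ?thesis using g by (intro mult_left_mono) auto
  qed
  also have "\<dots> = exp (2 * J) / 2 * (exp (- 2 * J) * x * gibbs N J \<sigma>)"
    by (simp add: exp_minus field_simps)
  also have "\<dots> \<le> exp (2 * J) / 2 * (real N * P_wolff N J \<sigma> ?t * gibbs N J \<sigma>)"
    using P g by (intro mult_left_mono mult_right_mono) auto
  finally show ?thesis .
qed

text \<open>
  The flips at different sites lead to different configurations, so the single-site transitions form a
  sub-sum of the Dirichlet form.
\<close>

lemma dirichlet_wolff_ge:
  "dirichlet_wolff N J f \<ge> 1 / 2 * (\<Sum>i\<in>{1..N}. \<Sum>\<sigma>\<in>configs N.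
     (f \<sigma> - f (\<sigma>(i := - \<sigma> i)))\<^sup>2 * P_wolff N J \<sigma> (\<sigma>(i := - \<sigma> i)) * gibbs N J \<sigma>)"
proof -
  have row: "(\<Sum>i\<in>{1..N}. (f \<eta> - f (\<eta>(i := - \<eta> i)))\<^sup>2 * P_wolff N J \<eta> (\<eta>(i := - \<eta> i)) * gibbs N J \<eta>)
    \<le> (\<Sum>\<sigma>\<in>configs N. (f \<sigma> - f \<eta>)\<^sup>2 * P_wolff N J \<eta> \<sigma> * gibbs N J \<eta>)" if e: "\<eta> \<in> configs N" for \<eta>
  proof -
    let ?F = "\<lambda>\<sigma>. (f \<sigma> - f \<eta>)\<^sup>2 * P_wolff N J \<eta> \<sigma> * gibbs N J \<eta>"
    have inj: "inj_on (\<lambda>i. \<eta>(i := - \<eta> i)) {1..N}"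
    proof (rule inj_onI, rule ccontr)
      fix i j assume i: "i \<in> {1..N}" and eq: "\<eta>(i := - \<eta> i) = \<eta>(j := - \<eta> j)" and "i \<noteq> j"
      then have "- \<eta> i = \<eta> i" by (metis fun_upd_same fun_upd_other)
      then show False using spin_of_config[OF e i] by auto
    qed
    have "(\<Sum>i\<in>{1..N}. (f \<eta> - f (\<eta>(i := - \<eta> i)))\<^sup>2 * P_wolff N J \<eta> (\<eta>(i := - \<eta> i)) * gibbs N J \<eta>)
      = (\<Sum>\<sigma>\<in>(\<lambda>i. \<eta>(i := - \<eta> i)) ` {1..N}. ?F \<sigma>)"
      unfolding sum.reindex[OF inj] o_def by (intro sum.cong refl) (simp only: power2_commute)
    also have "\<dots> \<le> (\<Sum>\<sigma>\<in>configs N. ?F \<sigma>)"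
      using flip_in_configs[OF e] gibbs_pos[of N J]
      by (intro sum_mono2 finite_configs) (auto simp: P_wolff_def less_imp_le)
    finally show ?thesis .
  qed
  show ?thesis
    unfolding dirichlet_wolff_def
    by (subst sum.swap, subst (2) sum.swap) (intro mult_left_mono sum_mono row; simp)
qed

theorem corollary3p10:
  fixes N :: nat and J :: real and f :: "(nat \<Rightarrow> real) \<Rightarrow> real"
  assumes "N \<ge> 1" and "J \<ge> 0"
  shows "gibbs_expect N J (\<lambda>\<sigma>. (f \<sigma>)\<^sup>2) - (gibbs_expect N J f)\<^sup>2
    \<le> exp (2 * J) * (exp (4 * J) + 1) / 2
      * (1 / 2 + J * exp ((exp (2 * J) - 1) / 2)) * real N * dirichlet_wolff N J f"
proof -
  interpret dobrushin_spin_system "{1..N}" "gibbs N J"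
    "\<lambda>i k. tanh (2 * J) / 2 * (of_bool (cpred N i = k) + of_bool (csucc N i = k))" "tanh (2 * J)"
    using assms by (rule ising_dobrushin)
  let ?V = "gibbs_expect N J (\<lambda>\<sigma>. (f \<sigma>)\<^sup>2) - (gibbs_expect N J f)\<^sup>2"
  let ?D = "real N * dirichlet_wolff N J f"
  let ?C = "exp (2 * J) * (exp (4 * J) + 1) / 2"
  have D: "?D \<ge> 0"
    unfolding dirichlet_wolff_def using gibbs_pos[of N J]
    by (intro mult_nonneg_nonneg sum_nonneg) (auto simp: P_wolff_def less_imp_le)
  have "(1 - tanh (2 * J)) * ?V \<le> (\<Sum>i\<in>{1..N}. \<Sum>\<sigma>\<in>configs N.
        gibbs N J \<sigma> * gibbs N J (\<sigma>(i := - \<sigma> i)) / (gibbs N J \<sigma> + gibbs N J (\<sigma>(i := - \<sigma> i)))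
        * (f \<sigma> - f (\<sigma>(i := - \<sigma> i)))\<^sup>2) / 2"
    using dobrushin_poincare[of f] unfolding gibbs_expect_def configs_def .
  also have "\<dots> \<le> (\<Sum>i\<in>{1..N}. \<Sum>\<sigma>\<in>configs N.
        exp (2 * J) / 2 * (real N * P_wolff N J \<sigma> (\<sigma>(i := - \<sigma> i)) * gibbs N J \<sigma>)
        * (f \<sigma> - f (\<sigma>(i := - \<sigma> i)))\<^sup>2) / 2"
    using assms by (intro divide_right_mono sum_mono mult_right_mono wolff_dominates_heat_bath) auto
  also have "\<dots> = exp (2 * J) / 2 * real N * (1 / 2 * (\<Sum>i\<in>{1..N}. \<Sum>\<sigma>\<in>configs N.
     (f \<sigma> - f (\<sigma>(i := - \<sigma> i)))\<^sup>2 * P_wolff N J \<sigma> (\<sigma>(i := - \<sigma> i)) * gibbs N J \<sigma>))"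
    by (simp add: sum_distrib_left mult_ac)
  also have "\<dots> \<le> exp (2 * J) / 2 * real N * dirichlet_wolff N J f"
    by (intro mult_left_mono dirichlet_wolff_ge) auto
  finally have main: "(1 - tanh (2 * J)) * ?V \<le> exp (2 * J) / 2 * ?D" by (simp add: mult.assoc)
  \<comment> \<open>\<open>1 - tanh (2 J) = 2 / (e\<^sup>4\<^sup>J + 1)\<close>\<close>
  have gap: "(exp (4 * J) + 1) / 2 * (1 - tanh (2 * J)) = 1"
  proof -
    have "exp (4 * J) = exp (2 * J) * exp (2 * J)" by (simp flip: exp_add)
    moreover have "1 - tanh (2 * J) = 2 / (exp (2 * J) * exp (2 * J) + 1)"
      unfolding tanh_altdef
      by (simp add: exp_minus divide_simps add_pos_pos less_imp_neq[THEN not_sym])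
    moreover have "exp (2 * J) * exp (2 * J) + 1 > 0" by (intro add_pos_pos) auto
    ultimately show ?thesis by simp
  qed
  have "?V = (exp (4 * J) + 1) / 2 * ((1 - tanh (2 * J)) * ?V)"
    using gap by (metis mult.assoc mult_1)
  also have "\<dots> \<le> (exp (4 * J) + 1) / 2 * (exp (2 * J) / 2 * ?D)"
    by (intro mult_left_mono main) (simp add: add_nonneg_nonneg)
  also have "\<dots> = ?C * (1 / 2) * ?D" by simp
  also have "\<dots> \<le> ?C * (1 / 2 + J * exp ((exp (2 * J) - 1) / 2)) * ?D"
    using assms D by (intro mult_right_mono mult_left_mono) (auto simp: add_nonneg_nonneg)
  finally show ?thesis by (simp add: mult.assoc)
qed

end
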